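(* Let $G$ be a nontrivial finite soluble group that can be generated by $2$ elements. Then either $d_I(G)\ge \min \pi(G)$, or there exists a finite soluble group $H$ having $G$ as an epimorphic image and such that (i) $d(H)=2$; (ii) $d_I(H)>d_I(G)$; (iii) $\min\pi(H)=\min\pi(G)$.
   Context: For a finite group $G$: $\pi(G)$ is the set of primes dividing $|G|$; $d(G)$ is the smallest cardinality of a generating set of $G$. A subset $S\subseteq G$ invariably generates $G$ if $G=\langle s^{g(s)} \mid s\in S\rangle$ for every choice of elements $g(s)\in G$, $s\in S$ (where $s^{g}=g^{-1}sg$). $d_I(G)$ denotes the smallest cardinality of a subset that invariably generates $G$. *)

theory Defs
  imports "HOL-Algebra.Solvable_Groups" "HOL-Computational_Algebra.Primes"
begin

definition group_primes :: "('a, 'b) monoid_scheme \<Rightarrow> nat set" where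
  "group_primes G = {p. prime p \<and> p dvd card (carrier G)}"

definition generates :: "('a, 'b) monoid_scheme \<Rightarrow> 'a set \<Rightarrow> bool" where
  "generates G S \<longleftrightarrow> S \<subseteq> carrier G \<and> generate G S = carrier G"

definition invariably_generates :: "('a, 'b) monoid_scheme \<Rightarrow> 'a set \<Rightarrow> bool" where
  "invariably_generates G S \<longleftrightarrow> S \<subseteq> carrier G \<and>
     (\<forall>g \<in> S \<rightarrow> carrier G.
        generate G ((\<lambda>s. inv\<^bsub>G\<^esub> (g s) \<otimes>\<^bsub>G\<^esub> s \<otimes>\<^bsub>G\<^esub> g s) ` S) = carrier G)"

(* The two ranks below are meant for finite groups only: there the whole carrier
   generates, and also generates invariably, so a least cardinality exists. For other groups
   the set may be empty and LEAST then returns an unspecified number. *)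

definition gen_rank :: "('a, 'b) monoid_scheme \<Rightarrow> nat" where
  "gen_rank G = (LEAST n. \<exists>S. finite S \<and> card S = n \<and> generates G S)"

definition inv_gen_rank :: "('a, 'b) monoid_scheme \<Rightarrow> nat" where
  "inv_gen_rank G = (LEAST n. \<exists>S. finite S \<and> card S = n \<and> invariably_generates G S)"

end

theory Submission
  imports Defs "HOL-Algebra.Multiplicative_Group" "HOL-Algebra.Weak_Morphisms"
    "HOL-Number_Theory.Cong" "HOL-Library.Function_Algebras" Complex_Main
begin

text \<open>Let \<open>p\<close> be the least prime divisor of the order of \<open>G\<close> and suppose \<open>d\<^sub>I(G) < p\<close>. Let \<open>r\<close> be a
  prime larger than \<open>|G|\<close>. The group \<open>H\<close> is a split extension of an elementary abelian \<open>r\<close>-group \<open>B\<close> by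
  \<open>G\<close>, with \<open>B\<close> so large that few elements cannot generate \<open>H\<close> invariably, although two elements
  generate it. Solubility, the epimorphism onto \<open>G\<close> and the least prime divisor are then immediate.

  To obtain \<open>H\<close>, take the free module \<open>A\<close> of rank two over the group ring of \<open>G\<close> with coefficients
  modulo \<open>r\<close>, with basis \<open>\<alpha>, \<beta>\<close>, and generators \<open>x, y\<close> of \<open>G\<close>. The subgroup generated by \<open>(\<alpha>, x)\<close> and
  \<open>(\<beta>, y)\<close> in the split extension of \<open>A\<close> by \<open>G\<close> has two generators by construction. By averaging it
  is conjugate to the split extension of its module part \<open>B\<close> by \<open>G\<close>, and a Schreier-type argument
  shows that \<open>B\<close> has dimension at least \<open>|G|\<close> (\<open>obtain_two_generated_sdp\<close>).

  Now consider elements \<open>h\<^sub>1, \<dots>, h\<^sub>k\<close> of \<open>H\<close> with \<open>k < p\<close> and nontrivial images \<open>g\<^sub>i\<close> in \<open>G\<close>, of orders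
  \<open>o\<^sub>i \<ge> p\<close>. The power of \<open>h\<^sub>i\<close> with exponent \<open>o\<^sub>i\<close> lies in \<open>B\<close> and is fixed by \<open>g\<^sub>i\<close>, so that it has at
  most \<open>|G| / p\<close> conjugates. All these conjugates span a submodule of dimension at most
  \<open>k |G| / p < |G|\<close>, hence a proper one, \<open>B\<^sub>0\<close>. Modulo \<open>B\<^sub>0\<close> the \<open>h\<^sub>i\<close> have order prime to \<open>r\<close>, and
  averaging over the powers of \<open>g\<^sub>i\<close> conjugates each of them into the complement \<open>G\<close>. Suitable
  conjugates therefore lie in the proper subgroup \<open>B\<^sub>0 G\<close> (\<open>not_invariably_generates\<close>). A set of at most
  \<open>d\<^sub>I(G)\<close> elements that generates \<open>H\<close> invariably would be of this kind, because the image in \<open>G\<close> of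
  such a set has no element to spare. So \<open>d\<^sub>I(H) > d\<^sub>I(G) \<ge> 1\<close>, and \<open>H\<close> is not cyclic, whence
  \<open>d(H) = 2\<close>.\<close>

section \<open>Generating sets, epimorphisms and ranks\<close>

lemma gen_rank_le: "finite S \<Longrightarrow> generates G S \<Longrightarrow> gen_rank G \<le> card S"
  unfolding gen_rank_def by (rule Least_le) blast

lemma inv_gen_rank_le: "finite S \<Longrightarrow> invariably_generates G S \<Longrightarrow> inv_gen_rank G \<le> card S"
  unfolding inv_gen_rank_def by (rule Least_le) blast

text \<open>Count the pairs \<open>(g, k)\<close> with \<open>k \<noteq> \<one>\<close> in the subgroup: \<open>g k g\<^sup>-\<^sup>1\<close> is unchanged when \<open>(g, k)\<close> is
  replaced by \<open>(g l, l\<^sup>-\<^sup>1 k l)\<close> with \<open>l\<close> in the subgroup \<open>K\<close>, so the conjugates contain at most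
  \<open>|G| (|K| - 1) / |K|\<close> nontrivial elements, which is fewer than \<open>|G| - 1\<close>.\<close>

lemma conjugates_of_proper_subgroup_do_not_cover:
  assumes "group G" and fin: "finite (carrier G)" and K: "subgroup K G" "K \<noteq> carrier G"
  obtains x where "x \<in> carrier G"
    "\<And>g. g \<in> carrier G \<Longrightarrow> inv\<^bsub>G\<^esub> g \<otimes>\<^bsub>G\<^esub> x \<otimes>\<^bsub>G\<^esub> g \<notin> K"
proof -
  interpret group G by fact
  interpret K: subgroup K G by fact
  have finK: "finite K" using K.subset fin finite_subset by blast
  define P where "P = carrier G \<times> (K - {\<one>\<^bsub>G\<^esub>})"
  define h where "h = (\<lambda>(g, k). g \<otimes>\<^bsub>G\<^esub> k \<otimes>\<^bsub>G\<^esub> inv\<^bsub>G\<^esub> g)"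
  have finP: "finite P" using fin finK by (simp add: P_def)
  have fibre: "card K \<le> card {q \<in> P. h q = y}" if "y \<in> h ` P" for y
  proof -
    obtain g k where gk: "g \<in> carrier G" "k \<in> K" "k \<noteq> \<one>\<^bsub>G\<^esub>" "y = g \<otimes>\<^bsub>G\<^esub> k \<otimes>\<^bsub>G\<^esub> inv\<^bsub>G\<^esub> g"
      using \<open>y \<in> h ` P\<close> by (auto simp: P_def h_def)
    let ?e = "\<lambda>l. (g \<otimes>\<^bsub>G\<^esub> l, inv\<^bsub>G\<^esub> l \<otimes>\<^bsub>G\<^esub> k \<otimes>\<^bsub>G\<^esub> l)"
    have kc: "k \<in> carrier G" using gk K.subset by blast
    have "?e l \<in> {q \<in> P. h q = y}" if "l \<in> K" for l
    proof -
      have lc: "l \<in> carrier G" using that K.subset by blast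
      have "inv\<^bsub>G\<^esub> l \<otimes>\<^bsub>G\<^esub> k \<otimes>\<^bsub>G\<^esub> l \<noteq> \<one>\<^bsub>G\<^esub>"
      proof
        assume "inv\<^bsub>G\<^esub> l \<otimes>\<^bsub>G\<^esub> k \<otimes>\<^bsub>G\<^esub> l = \<one>\<^bsub>G\<^esub>"
        then have "k \<otimes>\<^bsub>G\<^esub> l = l"
          using lc kc by (metis inv_closed inv_equality inv_inv m_assoc m_closed)
        then show False using gk(3) lc kc by (metis l_one one_closed right_cancel)
      qed
      moreover have "(g \<otimes>\<^bsub>G\<^esub> l) \<otimes>\<^bsub>G\<^esub> (inv\<^bsub>G\<^esub> l \<otimes>\<^bsub>G\<^esub> k \<otimes>\<^bsub>G\<^esub> l) \<otimes>\<^bsub>G\<^esub> inv\<^bsub>G\<^esub> (g \<otimes>\<^bsub>G\<^esub> l) = y"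
      proof -
        have "(g \<otimes>\<^bsub>G\<^esub> l) \<otimes>\<^bsub>G\<^esub> (inv\<^bsub>G\<^esub> l \<otimes>\<^bsub>G\<^esub> k \<otimes>\<^bsub>G\<^esub> l) = g \<otimes>\<^bsub>G\<^esub> (k \<otimes>\<^bsub>G\<^esub> l)"
          using gk(1) lc kc
          by (metis (no_types, lifting) inv_closed inv_solve_left m_assoc m_closed)
        then show ?thesis using gk lc kc
          by (simp add: inv_mult_group m_assoc) (simp add: m_assoc [symmetric])
      qed
      ultimately show ?thesis using that gk lc by (simp add: P_def h_def)
    qed
    moreover have "inj_on ?e K"
      using inj_on_subset[OF inj_on_cmult[OF gk(1)] K.subset] by (auto simp: inj_on_def)
    ultimately show ?thesis
      using finP by (intro card_inj_on_le[of ?e]) auto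
  qed
  have "card (h ` P) * card K \<le> (\<Sum>y\<in>h ` P. card {q \<in> P. h q = y})"
    using sum_mono[of "h ` P" "\<lambda>_. card K", OF fibre] by simp
  also have "\<dots> = card P" using sum.image_gen[OF finP, of "\<lambda>_. 1::nat" h] by simp
  also have "\<dots> = card (carrier G) * (card K - 1)"
    using finK by (simp add: P_def card_cartesian_product)
  finally have le: "card (h ` P) * card K \<le> card (carrier G) * (card K - 1)" .
  have "\<not> carrier G - {\<one>\<^bsub>G\<^esub>} \<subseteq> h ` P"
  proof
    assume "carrier G - {\<one>\<^bsub>G\<^esub>} \<subseteq> h ` P"
    then have "card (carrier G) - 1 \<le> card (h ` P)"
      using card_mono[of "h ` P" "carrier G - {\<one>\<^bsub>G\<^esub>}"] finP fin by simp
    then have "(card (carrier G) - 1) * card K \<le> card (carrier G) * (card K - 1)"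
      using le by (meson le_trans mult_le_mono1)
    moreover have "card K > 0" using finK K.one_closed card_gt_0_iff by blast
    moreover have "card K \<le> card (carrier G)" using fin K.subset by (rule card_mono)
    ultimately have "card (carrier G) \<le> card K"
      by (simp add: diff_mult_distrib diff_mult_distrib2)
        (use mult_le_mono1[of 1 "card K" "card (carrier G)"]
             mult_le_mono2[of 1 "card K" "card (carrier G)"] in linarith)
    then show False using K fin K.subset by (metis card_seteq)
  qed
  then obtain x where x: "x \<in> carrier G" "x \<noteq> \<one>\<^bsub>G\<^esub>" "x \<notin> h ` P" by blast
  show thesis
  proof (rule that[OF x(1)])
    fix g assume g: "g \<in> carrier G"
    show "inv\<^bsub>G\<^esub> g \<otimes>\<^bsub>G\<^esub> x \<otimes>\<^bsub>G\<^esub> g \<notin> K"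
    proof
      assume "inv\<^bsub>G\<^esub> g \<otimes>\<^bsub>G\<^esub> x \<otimes>\<^bsub>G\<^esub> g \<in> K"
      moreover have "x = g \<otimes>\<^bsub>G\<^esub> (inv\<^bsub>G\<^esub> g \<otimes>\<^bsub>G\<^esub> x \<otimes>\<^bsub>G\<^esub> g) \<otimes>\<^bsub>G\<^esub> inv\<^bsub>G\<^esub> g"
        using x g by (metis inv_closed inv_solve_left inv_solve_right m_assoc m_closed)
      moreover from this have "inv\<^bsub>G\<^esub> g \<otimes>\<^bsub>G\<^esub> x \<otimes>\<^bsub>G\<^esub> g \<noteq> \<one>\<^bsub>G\<^esub>" using x g by auto
      ultimately have "x \<in> h ` P"
        using g by (intro image_eqI[of _ _ "(g, inv\<^bsub>G\<^esub> g \<otimes>\<^bsub>G\<^esub> x \<otimes>\<^bsub>G\<^esub> g)"]) (simp_all add: h_def P_def)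
      with x show False by blast
    qed
  qed
qed

text \<open>This makes the invariable rank of a finite group an attained minimum, without which no lower
  bound on it could be proved.\<close>

lemma carrier_invariably_generates:
  assumes "group G" "finite (carrier G)"
  shows "invariably_generates G (carrier G)"
  unfolding invariably_generates_def
proof (intro conjI ballI subset_refl)
  interpret group G by fact
  fix g assume g: "g \<in> carrier G \<rightarrow> carrier G"
  let ?C = "(\<lambda>s. inv\<^bsub>G\<^esub> (g s) \<otimes>\<^bsub>G\<^esub> s \<otimes>\<^bsub>G\<^esub> g s) ` carrier G"
  have sub: "subgroup (generate G ?C) G" by (rule generate_is_subgroup) (use g in auto)
  show "generate G ?C = carrier G"
  proof (rule ccontr)
    assume "generate G ?C \<noteq> carrier G"
    then obtain x where "x \<in> carrier G"
      "\<And>g. g \<in> carrier G \<Longrightarrow> inv\<^bsub>G\<^esub> g \<otimes>\<^bsub>G\<^esub> x \<otimes>\<^bsub>G\<^esub> g \<notin> generate G ?C"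
      using conjugates_of_proper_subgroup_do_not_cover[OF assms sub] by blast
    then show False using g by (meson Pi_mem generate.incl image_eqI)
  qed
qed

lemma obtain_min_generating_set:
  assumes "group G" "finite (carrier G)"
  obtains S where "finite S" "card S = gen_rank G" "generates G S"
proof -
  interpret group G by fact
  have "generates G (carrier G)"
    unfolding generates_def using generate_incl[of "carrier G"] by (auto intro: generate.incl)
  then have "\<exists>S. finite S \<and> card S = card (carrier G) \<and> generates G S"
    using assms by blast
  from LeastI[of "\<lambda>n. \<exists>S. finite S \<and> card S = n \<and> generates G S", OF this] that
  show ?thesis unfolding gen_rank_def by blast
qed

lemma obtain_min_invariably_generating_set:
  assumes "group G" "finite (carrier G)"
  obtains S where "finite S" "card S = inv_gen_rank G" "invariably_generates G S"
proof -
  have "\<exists>S. finite S \<and> card S = card (carrier G) \<and> invariably_generates G S"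
    using assms carrier_invariably_generates by blast
  from LeastI[of "\<lambda>n. \<exists>S. finite S \<and> card S = n \<and> invariably_generates G S", OF this] that
  show ?thesis unfolding inv_gen_rank_def by blast
qed

lemma generates_epi_image:
  assumes "group H" "group G" "f \<in> epi H G" "generates H S"
  shows "generates G (f ` S)"
proof -
  interpret group_hom H G f
    using assms by (simp add: group_hom_def group_hom_axioms_def epi_def)
  show ?thesis
    using assms generate_img[of S] by (auto simp: generates_def epi_def)
qed

text \<open>Conjugating elements in the image can be lifted, which turns a family of conjugates of the
  images into the image of a family of conjugates.\<close>

lemma invariably_generates_epi_image:
  assumes "group H" "group G" "f \<in> epi H G" "invariably_generates H S"
  shows "invariably_generates G (f ` S)"
proof -
  interpret group_hom H G f
    using assms by (simp add: group_hom_def group_hom_axioms_def epi_def)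
  have S: "S \<subseteq> carrier H" and surj: "f ` carrier H = carrier G"
    using assms by (auto simp: invariably_generates_def epi_def)
  show ?thesis
    unfolding invariably_generates_def
  proof (intro conjI ballI)
    show "f ` S \<subseteq> carrier G" using S by auto
    fix g assume g: "g \<in> f ` S \<rightarrow> carrier G"
    have "\<exists>x. x \<in> carrier H \<and> f x = g (f s)" if "s \<in> S" for s
    proof -
      have "g (f s) \<in> f ` carrier H" unfolding surj using g that by blast
      then show ?thesis by (metis imageE)
    qed
    then obtain g' where g': "\<And>s. s \<in> S \<Longrightarrow> g' s \<in> carrier H \<and> f (g' s) = g (f s)" by metis
    let ?C = "(\<lambda>s. inv\<^bsub>H\<^esub> (g' s) \<otimes>\<^bsub>H\<^esub> s \<otimes>\<^bsub>H\<^esub> g' s) ` S"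
    have C: "?C \<subseteq> carrier H" using S g' by auto
    have "f ` ?C = (\<lambda>s. inv\<^bsub>G\<^esub> (g s) \<otimes>\<^bsub>G\<^esub> s \<otimes>\<^bsub>G\<^esub> g s) ` f ` S"
      unfolding image_image
      by (rule image_cong[OF refl]) (use S g' in \<open>simp add: subset_iff\<close>)
    moreover have "generate H ?C = carrier H"
      using assms(4) g' unfolding invariably_generates_def by (simp add: Pi_iff)
    ultimately show "generate G ((\<lambda>s. inv\<^bsub>G\<^esub> (g s) \<otimes>\<^bsub>G\<^esub> s \<otimes>\<^bsub>G\<^esub> g s) ` f ` S) = carrier G"
      using generate_img[OF C] surj by simp
  qed
qed

lemma gen_rank_epi_le:
  assumes "group H" "finite (carrier H)" "group G" "f \<in> epi H G"
  shows "gen_rank G \<le> gen_rank H"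
proof -
  obtain S where S: "finite S" "card S = gen_rank H" "generates H S"
    using obtain_min_generating_set assms by blast
  then have "gen_rank G \<le> card (f ` S)"
    using generates_epi_image assms by (intro gen_rank_le) blast+
  also have "\<dots> \<le> card S" using S by (intro card_image_le)
  finally show ?thesis using S by simp
qed

lemma inv_gen_rank_epi_le:
  assumes "group H" "finite (carrier H)" "group G" "f \<in> epi H G"
  shows "inv_gen_rank G \<le> inv_gen_rank H"
proof -
  obtain S where S: "finite S" "card S = inv_gen_rank H" "invariably_generates H S"
    using obtain_min_invariably_generating_set assms by blast
  then have "inv_gen_rank G \<le> card (f ` S)"
    using invariably_generates_epi_image assms by (intro inv_gen_rank_le) blast+
  also have "\<dots> \<le> card S" using S by (intro card_image_le)
  finally show ?thesis using S by simp
qed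

text \<open>A cyclic group is abelian, so that conjugation changes nothing. This bounds the ordinary rank
  from below once the invariable rank is known to be at least two.\<close>

lemma inv_gen_rank_le_1_if_gen_rank_le_1:
  assumes "group G" "finite (carrier G)" "gen_rank G \<le> 1"
  shows "inv_gen_rank G \<le> 1"
proof -
  interpret group G by fact
  obtain S where S: "finite S" "card S = gen_rank G" "generates G S"
    using obtain_min_generating_set assms by blast
  obtain a where a: "a \<in> carrier G" "generate G {a} = carrier G"
  proof (cases "S = {}")
    case True
    then show thesis using that[of "\<one>\<^bsub>G\<^esub>"] S generate_one generate_empty
      by (simp add: generates_def)
  next
    case False
    then have "card S \<noteq> 0" using S(1) by simp
    then have "card S = 1" using S(2) assms(3) by linarith
    then show thesis using that S by (auto simp: generates_def card_1_singleton_iff)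
  qed
  have "inv\<^bsub>G\<^esub> g \<otimes>\<^bsub>G\<^esub> a \<otimes>\<^bsub>G\<^esub> g = a" if g: "g \<in> carrier G" for g
  proof -
    obtain k :: int where k: "g = a [^]\<^bsub>G\<^esub> k" using g a generate_pow[OF a(1)] by auto
    have "a \<otimes>\<^bsub>G\<^esub> g = g \<otimes>\<^bsub>G\<^esub> a" unfolding k using a(1) int_pow_mult[of a 1 k] int_pow_mult[of a k 1]
      by (simp add: add.commute)
    then show ?thesis using a g by (simp add: m_assoc) (simp add: m_assoc[symmetric])
  qed
  then have "invariably_generates G {a}" using a by (simp add: invariably_generates_def)
  then show ?thesis using inv_gen_rank_le[of "{a}" G] by simp
qed

text \<open>A minimal invariably generating set avoids the identity, because discarding it changes
  none of the subgroups generated by conjugates.\<close>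

lemma invariably_generates_Diff_one:
  assumes "group G" "invariably_generates G S"
  shows "invariably_generates G (S - {\<one>\<^bsub>G\<^esub>})"
  unfolding invariably_generates_def
proof (intro conjI ballI)
  interpret group G by fact
  have S: "S \<subseteq> carrier G" using assms by (simp add: invariably_generates_def)
  then show "S - {\<one>\<^bsub>G\<^esub>} \<subseteq> carrier G" by blast
  fix g assume g: "g \<in> S - {\<one>\<^bsub>G\<^esub>} \<rightarrow> carrier G"
  let ?c = "\<lambda>s. inv\<^bsub>G\<^esub> (g s) \<otimes>\<^bsub>G\<^esub> s \<otimes>\<^bsub>G\<^esub> g s"
  let ?g = "g(\<one>\<^bsub>G\<^esub> := \<one>\<^bsub>G\<^esub>)"
  have C: "?c ` (S - {\<one>\<^bsub>G\<^esub>}) \<subseteq> carrier G" using S g by (auto simp: Pi_iff subset_iff)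
  have "?g \<in> S \<rightarrow> carrier G" using g by auto
  then have "carrier G = generate G ((\<lambda>s. inv\<^bsub>G\<^esub> (?g s) \<otimes>\<^bsub>G\<^esub> s \<otimes>\<^bsub>G\<^esub> ?g s) ` S)"
    using assms(2) unfolding invariably_generates_def by blast
  also have "\<dots> \<subseteq> generate G (?c ` (S - {\<one>\<^bsub>G\<^esub>}))"
  proof (rule generate_subgroup_incl[OF _ generate_is_subgroup[OF C]], rule image_subsetI)
    fix s assume "s \<in> S"
    then show "inv\<^bsub>G\<^esub> (?g s) \<otimes>\<^bsub>G\<^esub> s \<otimes>\<^bsub>G\<^esub> ?g s \<in> generate G (?c ` (S - {\<one>\<^bsub>G\<^esub>}))"
      by (cases "s = \<one>\<^bsub>G\<^esub>") (auto intro: generate.one generate.incl)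
  qed
  finally show "generate G (?c ` (S - {\<one>\<^bsub>G\<^esub>})) = carrier G"
    using generate_incl[OF C] by blast
qed

lemma inv_gen_rank_pos:
  assumes "group G" "finite (carrier G)" "carrier G \<noteq> {\<one>\<^bsub>G\<^esub>}"
  shows "inv_gen_rank G > 0"
proof (rule ccontr)
  assume "\<not> inv_gen_rank G > 0"
  then obtain S where "finite S" "card S = 0" "invariably_generates G S"
    using obtain_min_invariably_generating_set[OF assms(1,2)] by (metis gr0I)
  then show False
    using assms group.generate_empty[OF assms(1)] by (simp add: invariably_generates_def)
qed

lemma finite_nonempty_group_primes:
  assumes "group G" "finite (carrier G)" "carrier G \<noteq> {\<one>\<^bsub>G\<^esub>}"
  shows "finite (group_primes G)" "group_primes G \<noteq> {}"
proof -
  interpret group G by fact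
  have pos: "card (carrier G) > 0" using assms(2) by (auto simp: card_gt_0_iff)
  show "finite (group_primes G)"
    by (rule finite_subset[OF _ finite_divisors_nat[OF pos]]) (auto simp: group_primes_def)
  have "card (carrier G) \<noteq> 1"
    using assms(3) one_closed by (metis card_1_singletonE singletonD)
  then obtain q where "prime q" "q dvd card (carrier G)" by (metis prime_factor_nat)
  then show "group_primes G \<noteq> {}" by (auto simp: group_primes_def)
qed

lemma (in group) Min_group_primes_le_ord:
  assumes "finite (carrier G)" "g \<in> carrier G" "g \<noteq> \<one>"
  shows "Min (group_primes G) \<le> ord g"
proof -
  have "carrier G \<noteq> {\<one>}" using assms by auto
  have "ord g \<noteq> 1" using assms ord_eq_1 by blast
  then obtain q where q: "prime q" "q dvd ord g" by (metis prime_factor_nat)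
  then have "q \<in> group_primes G"
    using ord_dvd_group_order[OF assms(2)] by (auto simp: group_primes_def order_def)
  then have "Min (group_primes G) \<le> q"
    using finite_nonempty_group_primes(1)[OF is_group assms(1) \<open>carrier G \<noteq> {\<one>}\<close>] by simp
  also have "q \<le> ord g" using dvd_imp_le[OF q(2)] ord_ge_1[OF assms(1,2)] by simp
  finally show ?thesis .
qed

section \<open>Monomial spans in a commutative monoid\<close>

text \<open>For elements of finite order this is the subgroup that they generate. Working in a
  commutative monoid and writing inverses as powers lets modules live in a type that is not a group.\<close>

definition mspan :: "'c::comm_monoid_mult set \<Rightarrow> 'c set" where
  "mspan T = range (\<lambda>e :: 'c \<Rightarrow> nat. \<Prod>v\<in>T. v ^ e v)"

lemma mspan_one: "1 \<in> mspan T"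
  unfolding mspan_def by (rule range_eqI[of _ _ "\<lambda>_. 0"]) simp

lemma mspan_mult:
  assumes "a \<in> mspan T" "b \<in> mspan T"
  shows "a * b \<in> mspan T"
proof -
  obtain d e where "a = (\<Prod>v\<in>T. v ^ d v)" "b = (\<Prod>v\<in>T. v ^ e v)"
    using assms unfolding mspan_def by blast
  then have "a * b = (\<Prod>v\<in>T. v ^ (d v + e v))" by (simp add: prod.distrib power_add)
  then show ?thesis unfolding mspan_def by (rule range_eqI[of _ _ "\<lambda>v. d v + e v"])
qed

lemma mspan_power: "a \<in> mspan T \<Longrightarrow> a ^ n \<in> mspan T"
  by (induction n) (auto intro: mspan_one mspan_mult)

lemma mspan_base:
  assumes "finite T" "v \<in> T"
  shows "v \<in> mspan T"
proof -
  have "(\<Prod>u\<in>T. u ^ (if u = v then 1 else 0)) = (\<Prod>u\<in>T. if u = v then u else 1)"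
    by (intro prod.cong) auto
  then show ?thesis
    using assms unfolding mspan_def by (intro range_eqI[of _ _ "\<lambda>u. if u = v then 1 else 0"]) simp
qed

lemma mult_closed_power:
  assumes "1 \<in> M" "\<And>a b. a \<in> M \<Longrightarrow> b \<in> M \<Longrightarrow> a * b \<in> M" "(a::'c::comm_monoid_mult) \<in> M"
  shows "a ^ n \<in> M"
  by (induction n) (use assms in auto)

lemma mult_closed_prod:
  fixes f :: "'i \<Rightarrow> 'c::comm_monoid_mult"
  assumes "1 \<in> M" "\<And>a b. a \<in> M \<Longrightarrow> b \<in> M \<Longrightarrow> a * b \<in> M" "\<And>i. i \<in> I \<Longrightarrow> f i \<in> M"
  shows "prod f I \<in> M"
  using assms(3) by (induction I rule: infinite_finite_induct) (use assms(1,2) in auto)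

lemma mspan_subset:
  assumes "1 \<in> M" "\<And>a b. a \<in> M \<Longrightarrow> b \<in> M \<Longrightarrow> a * b \<in> M" "T \<subseteq> M"
  shows "mspan T \<subseteq> M"
  unfolding mspan_def using assms
  by (auto intro!: mult_closed_prod[of M] mult_closed_power[of M])

lemma power_mod_exponent:
  fixes v :: "'c::comm_monoid_mult"
  assumes "v ^ r = 1"
  shows "v ^ (n mod r) = v ^ n"
proof -
  have "v ^ n = v ^ (r * (n div r) + n mod r)" by simp
  then show ?thesis by (simp only: power_add power_mult assms power_one mult_1_left)
qed

text \<open>Exponents only matter modulo the exponent of the generators.\<close>

lemma
  assumes fin: "finite T" and r: "r > 0" and exp: "\<And>v. v \<in> T \<Longrightarrow> v ^ r = 1"
  shows finite_mspan: "finite (mspan T)"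
    and card_mspan_le: "card (mspan T) \<le> r ^ card T"
proof -
  let ?P = "PiE T (\<lambda>_. {..<r})"
  let ?f = "\<lambda>e. \<Prod>v\<in>T. v ^ e v"
  have "mspan T \<subseteq> ?f ` ?P"
  proof
    fix a assume "a \<in> mspan T"
    then obtain e :: "'a \<Rightarrow> nat" where a: "a = ?f e" unfolding mspan_def by blast
    have "v ^ e v = v ^ (e v mod r)" if "v \<in> T" for v
      using power_mod_exponent[OF exp[OF that]] by simp
    then have "a = ?f (\<lambda>v\<in>T. e v mod r)" unfolding a by (intro prod.cong) auto
    moreover have "(\<lambda>v\<in>T. e v mod r) \<in> ?P" using r by auto
    ultimately show "a \<in> ?f ` ?P" by blast
  qed
  moreover have "finite ?P" using fin by (intro finite_PiE) auto
  moreover have "card ?P = r ^ card T" using fin by (simp add: card_PiE)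
  ultimately show "finite (mspan T)" "card (mspan T) \<le> r ^ card T"
    using surj_card_le[of ?P "mspan T" ?f] finite_surj by auto
qed

section \<open>Modules of coprime exponent and their semidirect products\<close>

text \<open>A finite module for a finite group \<open>G\<close>, written multiplicatively and annihilated by a number \<open>r\<close>
  prime to the order of \<open>G\<close>; inverses are \<open>(r - 1)\<close>-st powers. The carrier is a set, so that
  submodules are again instances with the same action.\<close>

locale torsion_module = group G for G (structure) +
  fixes act :: "'a \<Rightarrow> 'c::comm_monoid_mult \<Rightarrow> 'c" and r :: nat and A :: "'c set"
  assumes finite_group: "finite (carrier G)"
    and finite_module: "finite A"
    and r_pos: "r > 0"
    and coprime_order: "coprime r (order G)"
    and one_mem [simp, intro]: "1 \<in> A"
    and mult_mem [simp, intro]: "a \<in> A \<Longrightarrow> b \<in> A \<Longrightarrow> a * b \<in> A"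
    and exponent: "a \<in> A \<Longrightarrow> a ^ r = 1"
    and act_mem [simp, intro]: "g \<in> carrier G \<Longrightarrow> a \<in> A \<Longrightarrow> act g a \<in> A"
    and act_mult: "g \<in> carrier G \<Longrightarrow> a \<in> A \<Longrightarrow> b \<in> A \<Longrightarrow> act g (a * b) = act g a * act g b"
    and act_act: "g \<in> carrier G \<Longrightarrow> h \<in> carrier G \<Longrightarrow> a \<in> A \<Longrightarrow> act g (act h a) = act (g \<otimes> h) a"
    and act_one [simp]: "a \<in> A \<Longrightarrow> act \<one> a = a"
begin

text \<open>The split extension of \<open>B\<close> by \<open>G\<close>, where \<open>(a, g)\<close> stands for the product of \<open>a\<close> and \<open>g\<close>.\<close>

definition sdp :: "'c set \<Rightarrow> ('c \<times> 'a) monoid" where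
  "sdp B = \<lparr>carrier = B \<times> carrier G, monoid.mult = (\<lambda>(a, g) (b, h). (a * act g b, g \<otimes> h)), one = (1, \<one>)\<rparr>"

definition submodule :: "'c set \<Rightarrow> bool" where
  "submodule B \<longleftrightarrow> B \<subseteq> A \<and> 1 \<in> B \<and> (\<forall>a\<in>B. \<forall>b\<in>B. a * b \<in> B) \<and> (\<forall>g\<in>carrier G. \<forall>a\<in>B. act g a \<in> B)"

lemma carrier_sdp: "carrier (sdp B) = B \<times> carrier G"
  and mult_sdp: "(a, g) \<otimes>\<^bsub>sdp B\<^esub> (b, h) = (a * act g b, g \<otimes> h)"
  and one_sdp: "\<one>\<^bsub>sdp B\<^esub> = (1, \<one>)"
  and sdp_restrict: "(sdp A)\<lparr>carrier := B \<times> carrier G\<rparr> = sdp B"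
  by (simp_all add: sdp_def)

lemma order_pos: "order G > 0"
  using finite_group by (simp add: order_gt_0_iff_finite)

lemma power_mem [simp, intro]: "a \<in> A \<Longrightarrow> a ^ n \<in> A"
  by (rule mult_closed_power[of A]) auto

lemma prod_mem [intro]: "(\<And>i. i \<in> I \<Longrightarrow> f i \<in> A) \<Longrightarrow> prod f I \<in> A"
  by (rule mult_closed_prod[of A]) auto

lemma power_inverse: "a \<in> A \<Longrightarrow> a * a ^ (r - 1) = 1"
  using exponent[of a] r_pos by (metis Suc_diff_1 power_Suc)

lemma left_cancel: "a \<in> A \<Longrightarrow> a * b = a * c \<longleftrightarrow> b = c"
  by (metis mult.commute mult.assoc mult_1 power_inverse)

lemma act_1 [simp]: "g \<in> carrier G \<Longrightarrow> act g 1 = 1"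
  using act_mult[of g 1 1] left_cancel[of "act g 1" "act g 1" 1] by simp

lemma act_power: "g \<in> carrier G \<Longrightarrow> a \<in> A \<Longrightarrow> act g (a ^ n) = act g a ^ n"
  by (induction n) (simp_all add: act_mult)

lemma act_prod:
  assumes "g \<in> carrier G" "\<And>i. i \<in> I \<Longrightarrow> f i \<in> A"
  shows "act g (prod f I) = (\<Prod>i\<in>I. act g (f i))"
  using assms(2)
proof (induction I rule: infinite_finite_induct)
  case (insert i I)
  then show ?case using assms(1) by (simp add: act_mult prod_mem)
qed (use assms(1) in simp_all)

text \<open>Additively, \<open>m\<close> is division by \<open>k\<close>. Both averaging arguments below divide by the order of a
  group or of an element, and this is where coprimality enters.\<close>

lemma obtain_root_exponent:
  assumes "coprime r k"
  obtains m where "\<And>a. a \<in> A \<Longrightarrow> (a ^ k) ^ m = a"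
proof -
  obtain m where m: "[k * m = 1] (mod r)"
    using cong_solve_coprime_nat[of k r] assms by (auto simp: coprime_commute)
  have *: "a ^ (k * m) = a" if "a \<in> A" for a
    using m power_mod_exponent[OF exponent[OF that], of "k * m"]
      power_mod_exponent[OF exponent[OF that], of 1] by (simp add: cong_def)
  show thesis
    by (rule that[of m]) (use * in \<open>simp_all add: power_mult [symmetric] mult.commute\<close>)
qed

lemma group_sdp: "group (sdp A)"
proof (rule groupI)
  fix x assume "x \<in> carrier (sdp A)"
  then obtain a g where x: "x = (a, g)" "a \<in> A" "g \<in> carrier G" by (auto simp: carrier_sdp)
  show "\<exists>y\<in>carrier (sdp A). y \<otimes>\<^bsub>sdp A\<^esub> x = \<one>\<^bsub>sdp A\<^esub>"
  proof
    show "(act (inv g) (a ^ (r - 1)), inv g) \<in> carrier (sdp A)" using x by (simp add: carrier_sdp)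
    have "act (inv g) (a ^ (r - 1)) * act (inv g) a = act (inv g) (a ^ (r - 1) * a)"
      using x by (simp add: act_mult)
    then show "(act (inv g) (a ^ (r - 1)), inv g) \<otimes>\<^bsub>sdp A\<^esub> x = \<one>\<^bsub>sdp A\<^esub>"
      using x power_inverse[of a] by (simp add: mult_sdp one_sdp mult.commute)
  qed
qed (auto simp: carrier_sdp mult_sdp one_sdp act_mult act_act m_assoc mult.assoc)

lemma inv_sdp:
  assumes "a \<in> A" "g \<in> carrier G"
  shows "inv\<^bsub>sdp A\<^esub> (a, g) = (act (inv g) (a ^ (r - 1)), inv g)"
  using assms power_inverse[of a]
  by (intro group.inv_equality[OF group_sdp])
    (simp_all add: carrier_sdp mult_sdp one_sdp mult.commute flip: act_mult)

lemma torsion_module_submodule: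
  assumes "submodule B"
  shows "torsion_module G act r B"
  using assms finite_subset[OF _ finite_module]
  by unfold_locales
    (auto simp: submodule_def finite_group r_pos coprime_order exponent act_mult act_act subset_iff)

lemma subgroup_sdp:
  assumes "submodule B"
  shows "subgroup (B \<times> carrier G) (sdp A)"
proof (rule group.group_incl_imp_subgroup[OF group_sdp])
  show "B \<times> carrier G \<subseteq> carrier (sdp A)" using assms by (auto simp: submodule_def carrier_sdp)
  interpret B: torsion_module G act r B by (rule torsion_module_submodule) fact
  show "group (sdp A\<lparr>carrier := B \<times> carrier G\<rparr>)"
    using B.group_sdp by (simp add: sdp_def B.sdp_def)
qed

lemma snd_epi: "snd \<in> epi (sdp A) G"
  by (force simp: epi_def hom_def carrier_sdp mult_sdp)

lemma conj_by_module_element: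
  assumes "v \<in> A" "w \<in> A" "g \<in> carrier G"
  shows "inv\<^bsub>sdp A\<^esub> (v, \<one>) \<otimes>\<^bsub>sdp A\<^esub> (w, g) \<otimes>\<^bsub>sdp A\<^esub> (v, \<one>) = (v ^ (r - 1) * w * act g v, g)"
  using assms by (simp add: inv_sdp mult_sdp)

lemma subgroup_sdp_diff:
  assumes K: "subgroup K (sdp A)" and w: "(w, g) \<in> K" "(w', g) \<in> K"
  obtains b where "(b, \<one>) \<in> K" "w = b * w'"
proof -
  interpret K: subgroup K "sdp A" by fact
  have *: "w \<in> A" "w' \<in> A" "g \<in> carrier G" using K.subset w by (auto simp: carrier_sdp)
  have "(w * w' ^ (r - 1), \<one>) \<in> K"
    using K.m_closed[OF w(1) subgroup.m_inv_closed[OF K w(2)]] *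
    by (simp add: inv_sdp mult_sdp act_act)
  moreover have "w = w * w' ^ (r - 1) * w'"
    using power_inverse[of w'] * by (simp add: mult.assoc mult.commute[of "w' ^ _"])
  ultimately show thesis by (rule that)
qed

text \<open>The split extension sits in the exact sequence of the abelian module and \<open>G\<close>.\<close>

lemma solvable_sdp:
  assumes "solvable G"
  shows "solvable (sdp A)"
proof -
  interpret S: group "sdp A" by (rule group_sdp)
  let ?N = "\<lparr>carrier = A, monoid.mult = (*), one = 1\<rparr> :: 'c monoid"
  have "comm_group ?N"
    by (rule comm_groupI) (auto simp: ac_simps intro!: bexI[of _ "_ ^ (r - 1)"] power_inverse)
  then interpret N: comm_group ?N .
  show ?thesis
  proof (rule solvable_condition)
    show "group_hom ?N (sdp A) (\<lambda>a. (a, \<one>))"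
      by unfold_locales (simp add: hom_def carrier_sdp mult_sdp)
    show "group_hom (sdp A) G snd"
      using snd_epi by unfold_locales (simp add: epi_def)
    show "snd ` carrier (sdp A) = carrier G" using snd_epi by (simp add: epi_def)
    show "kernel (sdp A) G snd \<subseteq> (\<lambda>a. (a, \<one>)) ` carrier ?N"
      by (auto simp: kernel_def carrier_sdp)
    have "derived ?N (carrier ?N) = {\<one>\<^bsub>?N\<^esub>}" by (rule N.derived_eq_singleton) simp
    then show "solvable ?N"
      unfolding N.solvable_iff_trivial_derived_seq by (intro exI[of _ 1]) simp
  qed fact
qed

end

section \<open>Few elements cannot generate a large split extension invariably\<close>

context torsion_module
begin

lemma ord_pos: "g \<in> carrier G \<Longrightarrow> ord g > 0"
  using ord_ge_1[OF finite_group] by force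

text \<open>The stabiliser of \<open>v\<close> contains the powers of \<open>g\<close>, so every fibre of \<open>h \<mapsto> h v\<close> has at least
  \<open>ord g\<close> elements.\<close>

lemma card_orbit_times_ord_le:
  assumes "v \<in> A" and g: "g \<in> carrier G" "act g v = v"
  shows "card ((\<lambda>h. act h v) ` carrier G) * ord g \<le> order G"
proof -
  have pow: "act (g [^] j) v = v" for j :: nat
  proof (induction j)
    case (Suc j)
    have "act (g [^] Suc j) v = act (g [^] j) (act g v)"
      using assms(1) g(1) by (simp add: act_act)
    then show ?case using Suc g by simp
  qed (use assms in simp)
  have fibre: "ord g \<le> card {h \<in> carrier G. act h v = y}"
    if y: "y \<in> (\<lambda>h. act h v) ` carrier G" for y
  proof -
    obtain h where h: "h \<in> carrier G" "y = act h v" using y by blast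
    have "inj_on (\<lambda>j. h \<otimes> g [^] j) {0..ord g - 1}"
    proof (rule inj_onI)
      fix i j assume ij: "i \<in> {0..ord g - 1}" "j \<in> {0..ord g - 1}" "h \<otimes> g [^] i = h \<otimes> g [^] j"
      then have "g [^] i = g [^] j"
        using inj_onD[OF inj_on_cmult[OF h(1)] ij(3)] g(1) by blast
      then show "i = j" using inj_onD[OF ord_inj[OF g(1)]] ij(1,2) by blast
    qed
    moreover have "act (h \<otimes> g [^] j) v = y" for j :: nat
      using h g assms(1) pow[of j] act_act[of h "g [^] j" v] by simp
    then have "(\<lambda>j. h \<otimes> g [^] j) ` {0..ord g - 1} \<subseteq> {h \<in> carrier G. act h v = y}"
      using h(1) g(1) by blast
    ultimately have "card {0..ord g - 1} \<le> card {h \<in> carrier G. act h v = y}"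
      using finite_group by (intro card_inj_on_le) auto
    then show ?thesis using ord_pos[OF g(1)] by simp
  qed
  have "card ((\<lambda>h. act h v) ` carrier G) * ord g
      \<le> (\<Sum>y\<in>(\<lambda>h. act h v) ` carrier G. card {h \<in> carrier G. act h v = y})"
    using sum_mono[OF fibre] by simp
  also have "\<dots> = order G"
    using sum.image_gen[OF finite_group, of "\<lambda>_. 1::nat" "\<lambda>h. act h v"]
    by (simp add: order_def)
  finally show ?thesis .
qed

text \<open>This is the module element that \<open>(w, g)\<close> to the power \<open>ord g\<close> equals in the split extension.\<close>

definition act_norm :: "'a \<Rightarrow> 'c \<Rightarrow> 'c" where
  "act_norm g w = (\<Prod>j<ord g. act (g [^] j) w)"

lemma act_norm_mem [simp]: "g \<in> carrier G \<Longrightarrow> w \<in> A \<Longrightarrow> act_norm g w \<in> A"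
  unfolding act_norm_def by (rule prod_mem) auto

lemma act_prod_shift:
  fixes n :: nat
  assumes "g \<in> carrier G" "w \<in> A"
  shows "w * act g (\<Prod>i<n. act (g [^] i) w) = (\<Prod>i<n. act (g [^] i) w) * act (g [^] n) w"
proof -
  have "act g (\<Prod>i<n. act (g [^] i) w) = (\<Prod>i<n. act (g [^] Suc i) w)"
    using assms by (subst act_prod) (auto simp: act_act simp flip: nat_pow_Suc2 intro!: prod.cong)
  then have "w * act g (\<Prod>i<n. act (g [^] i) w) = (\<Prod>i<Suc n. act (g [^] i) w)"
    using assms by (subst prod.lessThan_Suc_shift) simp
  then show ?thesis by simp
qed

lemma act_act_norm:
  assumes "g \<in> carrier G" "w \<in> A"
  shows "act g (act_norm g w) = act_norm g w"
proof -
  have "w * act g (act_norm g w) = w * act_norm g w"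
    using act_prod_shift[OF assms, of "ord g"] assms
    by (simp add: act_norm_def mult.commute pow_ord_eq_1)
  then show ?thesis using assms left_cancel by simp
qed

text \<open>Additively, with \<open>o\<close> the order of \<open>g\<close> and \<open>N\<close> the sum of the powers of \<open>g\<close>, the element
  \<open>o w - N w\<close> equals \<open>v - g v\<close> for \<open>v\<close> the sum over \<open>n < o\<close> of the partial sums
  \<open>w + g w + \<dots> + g\<^sup>n\<^sup>-\<^sup>1 w\<close>. Dividing by \<open>o\<close> shows that conjugation by a module element moves \<open>(w, g)\<close>
  to an element whose module part is a multiple of \<open>N w\<close>.\<close>

lemma conjugate_to_power_of_act_norm:
  assumes g: "g \<in> carrier G" and w: "w \<in> A"
  obtains v m where "v \<in> A" "w * act g v = act_norm g w ^ m * v"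
proof -
  have "coprime r (ord g)"
    using coprime_order ord_dvd_group_order[OF g] by (meson coprime_divisors dvd_refl)
  then obtain m where m: "\<And>a. a \<in> A \<Longrightarrow> (a ^ ord g) ^ m = a"
    using obtain_root_exponent by metis
  define u where "u = (\<Prod>n<ord g. \<Prod>i<n. act (g [^] i) w)"
  have u: "u \<in> A" unfolding u_def using g w by (intro prod_mem) auto
  have "w ^ ord g * act g u = (\<Prod>n<ord g. w * act g (\<Prod>i<n. act (g [^] i) w))"
    unfolding u_def using g w by (subst act_prod) (auto simp: prod.distrib intro!: prod_mem)
  also have "\<dots> = u * act_norm g w"
    unfolding act_prod_shift[OF g w] by (simp add: prod.distrib u_def act_norm_def)
  finally have "(w ^ ord g) ^ m * act g (u ^ m) = act_norm g w ^ m * u ^ m"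
    using g u by (simp add: act_power power_mult_distrib [symmetric] mult.commute)
  then show thesis using that[of "u ^ m" m] m[OF w] u by simp
qed

lemma submodule_mspan:
  assumes T: "finite T" "T \<subseteq> A" and inv: "\<And>g v. g \<in> carrier G \<Longrightarrow> v \<in> T \<Longrightarrow> act g v \<in> T"
  shows "submodule (mspan T)"
proof -
  have "act g a \<in> mspan T" if g: "g \<in> carrier G" and "a \<in> mspan T" for g a
  proof -
    obtain e :: "'c \<Rightarrow> nat" where a: "a = (\<Prod>v\<in>T. v ^ e v)"
      using \<open>a \<in> mspan T\<close> unfolding mspan_def by blast
    have "act g a = (\<Prod>v\<in>T. act g (v ^ e v))"
      unfolding a by (rule act_prod) (use g T in auto)
    also have "\<dots> = (\<Prod>v\<in>T. act g v ^ e v)"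
      using g T by (intro prod.cong) (auto simp: act_power)
    also have "\<dots> \<in> mspan T"
      using inv[OF g] mspan_base[OF T(1)]
      by (intro mult_closed_prod) (auto intro: mspan_one mspan_mult mspan_power)
    finally show ?thesis .
  qed
  moreover have "mspan T \<subseteq> A" using T by (intro mspan_subset) auto
  ultimately show ?thesis by (auto simp: submodule_def mspan_one intro: mspan_mult)
qed

text \<open>The norm of \<open>s = (w, g)\<close> is fixed by \<open>g\<close>, so its orbit has at most \<open>|G| / ord g \<le> |G| / q\<close>
  elements. The orbits of the norms of fewer than \<open>q\<close> elements thus have fewer than \<open>|G|\<close> elements
  altogether, and the submodule \<open>B\<close> that they span is too small to be \<open>A\<close>. Every element of \<open>S\<close> is
  conjugate into \<open>B \<times> G\<close>, a proper subgroup.\<close>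

theorem not_invariably_generates:
  assumes S: "finite S" "S \<subseteq> A \<times> carrier G" "\<And>s. s \<in> S \<Longrightarrow> snd s \<noteq> \<one>"
    and q: "card S < q" "\<And>g. g \<in> carrier G \<Longrightarrow> g \<noteq> \<one> \<Longrightarrow> q \<le> ord g"
    and r: "r > 1" and large: "r ^ order G \<le> card A"
  shows "\<not> invariably_generates (sdp A) S"
proof
  assume inv: "invariably_generates (sdp A) S"
  interpret W: group "sdp A" by (rule group_sdp)
  define N where "N s = act_norm (snd s) (fst s)" for s
  define orb where "orb s = (\<lambda>h. act h (N s)) ` carrier G" for s
  define T where "T = (\<Union>s\<in>S. orb s)"
  have N: "N s \<in> A" "act (snd s) (N s) = N s" if "s \<in> S" for s
    using S(2) that act_act_norm by (auto simp: N_def)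
  have T: "finite T" "T \<subseteq> A"
    using S N finite_group by (auto simp: T_def orb_def)
  have T_inv: "act g v \<in> T" if "g \<in> carrier G" "v \<in> T" for g v
  proof -
    obtain s h where "s \<in> S" "h \<in> carrier G" "v = act h (N s)"
      using \<open>v \<in> T\<close> by (auto simp: T_def orb_def)
    then have "act g v = act (g \<otimes> h) (N s)" "g \<otimes> h \<in> carrier G"
      using that N by (simp_all add: act_act)
    then show ?thesis using \<open>s \<in> S\<close> by (auto simp: T_def orb_def)
  qed
  have card_orb: "card (orb s) * q \<le> order G" if "s \<in> S" for s
  proof -
    have "snd s \<in> carrier G" using S(2) that by auto
    then have "card (orb s) * ord (snd s) \<le> order G"
      unfolding orb_def using card_orbit_times_ord_le[of "N s" "snd s"] N that by simp
    moreover have "q \<le> ord (snd s)" using q(2) S that by auto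
    ultimately show ?thesis by (meson le_trans mult_le_mono2)
  qed
  have "card T * q \<le> (\<Sum>s\<in>S. card (orb s)) * q"
    unfolding T_def by (intro mult_le_mono1 card_UN_le S)
  also have "\<dots> \<le> (\<Sum>s\<in>S. order G)" unfolding sum_distrib_right by (intro sum_mono card_orb)
  also have "\<dots> < order G * q" using q(1) order_pos by simp
  finally have card_T: "card T < order G" by simp
  define B where "B = mspan T"
  have B: "submodule B" unfolding B_def using T T_inv by (rule submodule_mspan)
  have "card B \<le> r ^ card T"
    unfolding B_def using T r exponent by (intro card_mspan_le) auto
  also have "\<dots> < r ^ order G" using card_T r by simp
  finally have "B \<noteq> A" using large by auto
  define L where "L = B \<times> carrier G"
  have L: "subgroup L (sdp A)" unfolding L_def using B by (rule subgroup_sdp)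
  have "\<exists>g\<in>carrier (sdp A). inv\<^bsub>sdp A\<^esub> g \<otimes>\<^bsub>sdp A\<^esub> s \<otimes>\<^bsub>sdp A\<^esub> g \<in> L" if s: "s \<in> S" for s
  proof -
    obtain w g where wg: "s = (w, g)" "w \<in> A" "g \<in> carrier G" using S(2) s by auto
    obtain v m where v: "v \<in> A" "w * act g v = act_norm g w ^ m * v"
      using conjugate_to_power_of_act_norm wg by metis
    let ?v = "v ^ (r - 1)"
    have "?v * w * act g v = w * act g v * ?v" by (simp only: mult_ac)
    also have "\<dots> = act_norm g w ^ m * (v * ?v)" unfolding v(2) by (rule mult.assoc)
    also have "\<dots> = N s ^ m" using power_inverse[OF v(1)] by (simp add: N_def wg)
    also have "N s \<in> T" using N(1)[OF s] s by (force simp: T_def orb_def)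
    then have "N s ^ m \<in> B" unfolding B_def using T by (intro mspan_power mspan_base)
    finally have "inv\<^bsub>sdp A\<^esub> (v, \<one>) \<otimes>\<^bsub>sdp A\<^esub> s \<otimes>\<^bsub>sdp A\<^esub> (v, \<one>) \<in> L"
      using conj_by_module_element[OF v(1) wg(2,3)] wg by (simp add: L_def)
    then show ?thesis using v(1) by (intro bexI[of _ "(v, \<one>)"]) (auto simp: carrier_sdp)
  qed
  then obtain c where c: "\<And>s. s \<in> S \<Longrightarrow> c s \<in> carrier (sdp A)"
    "\<And>s. s \<in> S \<Longrightarrow> inv\<^bsub>sdp A\<^esub> (c s) \<otimes>\<^bsub>sdp A\<^esub> s \<otimes>\<^bsub>sdp A\<^esub> c s \<in> L"
    by metis
  have "carrier (sdp A) = generate (sdp A) ((\<lambda>s. inv\<^bsub>sdp A\<^esub> (c s) \<otimes>\<^bsub>sdp A\<^esub> s \<otimes>\<^bsub>sdp A\<^esub> c s) ` S)"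
    using inv c(1) unfolding invariably_generates_def by blast
  also have "\<dots> \<subseteq> L" using c(2) by (intro W.generate_subgroup_incl[OF _ L]) auto
  finally show False
    using B \<open>B \<noteq> A\<close> by (auto simp: L_def carrier_sdp submodule_def)
qed

section \<open>Two-generated split extensions\<close>

text \<open>Both \<open>K\<close> modulo \<open>B\<close> and \<open>G\<close> are complements of the module modulo \<open>B\<close>, and such complements are
  conjugate: the conjugating element is the average over \<open>h\<close> of the module parts \<open>\<sigma> h\<close> of elements
  \<open>(\<sigma> h, h)\<close> of \<open>K\<close>. Up to \<open>B\<close>, a pair \<open>(w, g)\<close> in \<open>K\<close> satisfies \<open>w + g \<sigma> h = \<sigma> (g h)\<close>, and summation
  over \<open>h\<close> gives \<open>w + g t = t\<close>.\<close>

lemma subgroup_conjugate_to_sdp: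
  assumes K: "subgroup K (sdp A)" "snd ` K = carrier G"
  defines "B \<equiv> {a. (a, \<one>) \<in> K}"
  obtains t where "t \<in> A" "submodule B"
    "(\<lambda>k. inv\<^bsub>sdp A\<^esub> (t, \<one>) \<otimes>\<^bsub>sdp A\<^esub> k \<otimes>\<^bsub>sdp A\<^esub> (t, \<one>)) ` K = B \<times> carrier G"
proof -
  interpret K: subgroup K "sdp A" by fact
  have KA: "a \<in> A" "g \<in> carrier G" if "(a, g) \<in> K" for a g
    using K.subset that by (auto simp: carrier_sdp)
  have BA: "b \<in> A" if "b \<in> B" for b using that KA by (simp add: B_def)
  have B1: "1 \<in> B" using K.one_closed by (simp add: B_def one_sdp)
  have Bmult: "a * b \<in> B" if "a \<in> B" "b \<in> B" for a b
    using K.m_closed[of "(a, \<one>)" "(b, \<one>)"] that BA by (simp add: B_def mult_sdp)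
  have Binv: "a ^ (r - 1) \<in> B" if "a \<in> B" for a
    using mult_closed_power[OF B1 Bmult that] by simp
  have diff: "\<exists>b\<in>B. w = b * w'" if "(w, g) \<in> K" "(w', g) \<in> K" for w w' g
    using subgroup_sdp_diff[OF K(1) that] unfolding B_def by blast
  have "\<exists>a. (a, g) \<in> K" if "g \<in> carrier G" for g using K(2) that by force
  then obtain \<sigma> where \<sigma>: "\<And>g. g \<in> carrier G \<Longrightarrow> (\<sigma> g, g) \<in> K" by metis
  have \<sigma>A: "\<sigma> g \<in> A" if "g \<in> carrier G" for g using KA \<sigma> that by blast
  have Bact: "act g b \<in> B" if gb: "g \<in> carrier G" "b \<in> B" for g b
  proof -
    have "(\<sigma> g * act g b, g) \<in> K"
      using K.m_closed[OF \<sigma>[OF gb(1)], of "(b, \<one>)"] gb by (simp add: B_def mult_sdp)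
    then obtain b' where "b' \<in> B" "\<sigma> g * act g b = b' * \<sigma> g" using diff[OF _ \<sigma>[OF gb(1)]] by blast
    then have "act g b = b'" using left_cancel[OF \<sigma>A[OF gb(1)], of "act g b" b'] by (simp add: mult.commute[of b'])
    then show ?thesis using \<open>b' \<in> B\<close> by simp
  qed
  have sub: "submodule B" using B1 Bmult Bact BA by (auto simp: submodule_def)
  obtain m where m: "\<And>a. a \<in> A \<Longrightarrow> (a ^ order G) ^ m = a"
    using obtain_root_exponent[OF coprime_order] by metis
  define s where "s = (\<Prod>h\<in>carrier G. \<sigma> h)"
  define t where "t = s ^ m"
  have s: "s \<in> A" unfolding s_def using \<sigma>A by (rule prod_mem)
  then have t: "t \<in> A" by (simp add: t_def)
  have key: "\<exists>b\<in>B. w * act g t = b * t" if wg: "(w, g) \<in> K" for w g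
  proof -
    have g: "g \<in> carrier G" "w \<in> A" using KA wg by blast+
    have "\<exists>b\<in>B. w * act g (\<sigma> h) = b * \<sigma> (g \<otimes> h)" if "h \<in> carrier G" for h
      using K.m_closed[OF wg \<sigma>[OF that]] g that by (intro diff[of _ "g \<otimes> h"]) (auto simp: mult_sdp \<sigma>)
    then obtain b where b: "\<And>h. h \<in> carrier G \<Longrightarrow> b h \<in> B"
      "\<And>h. h \<in> carrier G \<Longrightarrow> w * act g (\<sigma> h) = b h * \<sigma> (g \<otimes> h)" by metis
    have "bij_betw ((\<otimes>) g) (carrier G) (carrier G)"
      unfolding bij_betw_def using g inj_on_cmult surj_const_mult by blast
    then have reindex: "(\<Prod>h\<in>carrier G. \<sigma> (g \<otimes> h)) = s"
      unfolding s_def by (rule prod.reindex_bij_betw)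
    have "w ^ order G * act g s = (\<Prod>h\<in>carrier G. w * act g (\<sigma> h))"
      unfolding s_def using g \<sigma>A by (subst act_prod) (auto simp: prod.distrib order_def)
    also have "\<dots> = (\<Prod>h\<in>carrier G. b h) * s"
      using b(2) by (simp add: prod.distrib reindex cong: prod.cong)
    finally have "(w ^ order G * act g s) ^ m = ((\<Prod>h\<in>carrier G. b h) * s) ^ m" by simp
    then have "w * act g t = (\<Prod>h\<in>carrier G. b h) ^ m * t"
      using m[OF g(2)] g s by (simp add: power_mult_distrib act_power t_def)
    moreover have "(\<Prod>h\<in>carrier G. b h) ^ m \<in> B"
      using mult_closed_power[OF B1 Bmult mult_closed_prod[OF B1 Bmult b(1)]] by simp
    ultimately show ?thesis by blast
  qed
  let ?c = "\<lambda>k. inv\<^bsub>sdp A\<^esub> (t, \<one>) \<otimes>\<^bsub>sdp A\<^esub> k \<otimes>\<^bsub>sdp A\<^esub> (t, \<one>)"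
  let ?t = "t ^ (r - 1)"
  have conj: "?c (w, g) = (?t * w * act g t, g)" if "(w, g) \<in> K" for w g
    using conj_by_module_element[OF t] KA[OF that] by simp
  have c_key: "\<exists>b\<in>B. ?c (w, g) = (b, g)" if wg: "(w, g) \<in> K" for w g
  proof -
    obtain b where b: "b \<in> B" "w * act g t = b * t" using key[OF wg] by blast
    have "?t * w * act g t = w * act g t * ?t" by (simp only: mult_ac)
    also have "\<dots> = b * (t * ?t)" unfolding b(2) by (rule mult.assoc)
    finally show ?thesis using conj[OF wg] b(1) power_inverse[OF t] by auto
  qed
  have "?c ` K = B \<times> carrier G"
  proof
    show "?c ` K \<subseteq> B \<times> carrier G" using c_key KA by force
    show "B \<times> carrier G \<subseteq> ?c ` K"
    proof clarify
      fix b g assume b: "b \<in> B" and g: "g \<in> carrier G"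
      obtain b' where b': "b' \<in> B" "?c (\<sigma> g, g) = (b', g)" using c_key \<sigma> g by blast
      let ?d = "b * b' ^ (r - 1)"
      have "(?d, \<one>) \<in> K" using Bmult[OF b Binv[OF b'(1)]] by (simp add: B_def)
      then have K': "(?d * \<sigma> g, g) \<in> K"
        using K.m_closed[OF _ \<sigma>[OF g], of "(?d, \<one>)"] g \<sigma>A by (simp add: mult_sdp)
      have "?c (?d * \<sigma> g, g) = (?d * (?t * \<sigma> g * act g t), g)"
        unfolding conj[OF K'] by (simp add: mult_ac)
      also have "\<dots> = (?d * b', g)" using b'(2) conj[OF \<sigma>[OF g]] by simp
      also have "?d * b' = b" using power_inverse[OF BA[OF b'(1)]] by (simp add: mult.assoc mult.commute[of "b' ^ _"])
      finally show "(b, g) \<in> ?c ` K" using K' by (metis image_eqI)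
    qed
  qed
  then show thesis using that t sub by blast
qed

text \<open>The subgroup \<open>K\<close> generated by \<open>(\<alpha>, x)\<close> and \<open>(\<beta>, y)\<close> maps onto \<open>G\<close> and is conjugate to \<open>B \<times> G\<close> with
  \<open>B\<close> its part in the module. To see that \<open>B\<close> is large, choose \<open>(\<sigma> u, u)\<close> in \<open>K\<close> for every \<open>u\<close>, as
  in Schreier's argument. Comparing \<open>(\<sigma> u, u) (\<alpha>, x)\<close> with \<open>(\<sigma> (u x), u x)\<close> expresses the translate
  \<open>u \<alpha>\<close>, modulo \<open>B\<close>, by the \<open>|G|\<close> elements \<open>\<sigma> v\<close>; the same holds for \<open>u \<beta>\<close>. The translates span \<open>A\<close>,
  so \<open>B\<close> has index at most \<open>r\<close> to the power \<open>|G|\<close>.\<close>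

theorem obtain_two_generated_sdp:
  assumes xy: "x \<in> carrier G" "y \<in> carrier G" "generate G {x, y} = carrier G"
    and ab: "\<alpha> \<in> A" "\<beta> \<in> A" "A \<subseteq> mspan (\<Union>u\<in>carrier G. {act u \<alpha>, act u \<beta>})"
  obtains B X Y where "submodule B" "card A \<le> card B * r ^ order G"
    "X \<in> B \<times> carrier G" "Y \<in> B \<times> carrier G" "generate (sdp B) {X, Y} = B \<times> carrier G"
proof -
  interpret W: group "sdp A" by (rule group_sdp)
  define K where "K = generate (sdp A) {(\<alpha>, x), (\<beta>, y)}"
  have gens: "{(\<alpha>, x), (\<beta>, y)} \<subseteq> carrier (sdp A)" using xy ab by (simp add: carrier_sdp)
  have K: "subgroup K (sdp A)" unfolding K_def using gens by (rule W.generate_is_subgroup)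
  interpret K: subgroup K "sdp A" by fact
  interpret p: group_hom "sdp A" G snd
    using snd_epi by unfold_locales (simp add: epi_def)
  have sndK: "snd ` K = carrier G"
    unfolding K_def using p.generate_img[OF gens] xy(3) by simp
  define B where "B = {a. (a, \<one>) \<in> K}"
  obtain t where t: "t \<in> A" and B: "submodule B" and
    conj: "(\<lambda>k. inv\<^bsub>sdp A\<^esub> (t, \<one>) \<otimes>\<^bsub>sdp A\<^esub> k \<otimes>\<^bsub>sdp A\<^esub> (t, \<one>)) ` K = B \<times> carrier G"
    using subgroup_conjugate_to_sdp[OF K sndK] unfolding B_def by blast
  let ?c = "\<lambda>k. inv\<^bsub>sdp A\<^esub> (t, \<one>) \<otimes>\<^bsub>sdp A\<^esub> k \<otimes>\<^bsub>sdp A\<^esub> (t, \<one>)"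
  have tW: "(t, \<one>) \<in> carrier (sdp A)" using t by (simp add: carrier_sdp)
  interpret c: group_hom "sdp A" "sdp A" ?c
  proof unfold_locales
    have "?c k \<otimes>\<^bsub>sdp A\<^esub> ?c l = ?c (k \<otimes>\<^bsub>sdp A\<^esub> l)" if "k \<in> carrier (sdp A)" "l \<in> carrier (sdp A)" for k l
    proof -
      have "(t, \<one>) \<otimes>\<^bsub>sdp A\<^esub> (inv\<^bsub>sdp A\<^esub> (t, \<one>) \<otimes>\<^bsub>sdp A\<^esub> (l \<otimes>\<^bsub>sdp A\<^esub> (t, \<one>))) = l \<otimes>\<^bsub>sdp A\<^esub> (t, \<one>)"
        using tW that by (simp add: W.m_assoc [symmetric])
      then show ?thesis using tW that by (simp add: W.m_assoc)
    qed
    then show "?c \<in> hom (sdp A) (sdp A)" using tW by (auto simp: hom_def)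
  qed
  let ?X = "?c (\<alpha>, x)" and ?Y = "?c (\<beta>, y)"
  have "(\<alpha>, x) \<in> K" "(\<beta>, y) \<in> K" unfolding K_def by (auto intro: generate.incl)
  then have XY: "?X \<in> B \<times> carrier G" "?Y \<in> B \<times> carrier G" and KX: "(\<alpha>, x) \<in> K" "(\<beta>, y) \<in> K"
    using conj by blast+
  have "generate (sdp A) {?X, ?Y} = B \<times> carrier G"
    using c.generate_img[OF gens] conj by (simp add: K_def)
  moreover have "generate (sdp B) {?X, ?Y} = generate (sdp A) {?X, ?Y}"
    using W.generate_consistent[OF _ subgroup_sdp[OF B], of "{?X, ?Y}"] XY
    unfolding sdp_restrict by blast
  ultimately have gen: "generate (sdp B) {?X, ?Y} = B \<times> carrier G" by simp
  have BA: "B \<subseteq> A" and B1: "1 \<in> B" and Bm: "\<And>a b. a \<in> B \<Longrightarrow> b \<in> B \<Longrightarrow> a * b \<in> B"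
    using B by (auto simp: submodule_def)
  have "\<exists>a. (a, g) \<in> K" if "g \<in> carrier G" for g using sndK that by force
  then obtain \<sigma> where \<sigma>: "\<And>g. g \<in> carrier G \<Longrightarrow> (\<sigma> g, g) \<in> K" by metis
  have \<sigma>A: "\<sigma> g \<in> A" if "g \<in> carrier G" for g using K.subset \<sigma>[OF that] by (auto simp: carrier_sdp)
  define C where "C = (\<lambda>(b, c). b * c) ` (B \<times> mspan (\<sigma> ` carrier G))"
  have CI: "b * c \<in> C" if "b \<in> B" "c \<in> mspan (\<sigma> ` carrier G)" for b c
    using that by (force simp: C_def)
  have C1: "1 \<in> C" using CI[OF B1 mspan_one] by simp
  have Cm: "a * b \<in> C" if ab: "a \<in> C" "b \<in> C" for a b
  proof -
    obtain a1 a2 b1 b2 where "a = a1 * a2" "b = b1 * b2" "a1 \<in> B" "b1 \<in> B"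
      "a2 \<in> mspan (\<sigma> ` carrier G)" "b2 \<in> mspan (\<sigma> ` carrier G)"
      using ab by (auto simp: C_def)
    then show ?thesis using CI[OF Bm[of a1 b1] mspan_mult[of a2 _ b2]] by (simp add: mult_ac)
  qed
  have \<sigma>C: "\<sigma> g ^ n \<in> mspan (\<sigma> ` carrier G)" if "g \<in> carrier G" for g n
    using that finite_group by (intro mspan_power mspan_base) auto
  have translate: "act u a \<in> C" if a: "(a, z) \<in> K" and u: "u \<in> carrier G" for a u z
  proof -
    have z: "z \<in> carrier G" using K.subset a by (auto simp: carrier_sdp)
    have uz: "u \<otimes> z \<in> carrier G" using u z by simp
    have "(\<sigma> u * act u a, u \<otimes> z) \<in> K" using K.m_closed[OF \<sigma>[OF u] a] by (simp add: mult_sdp)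
    then obtain b where b: "b \<in> B" "\<sigma> u * act u a = b * \<sigma> (u \<otimes> z)"
      using subgroup_sdp_diff[OF K _ \<sigma>[OF uz]] unfolding B_def by blast
    have "b * (\<sigma> (u \<otimes> z) ^ 1 * \<sigma> u ^ (r - 1)) \<in> C"
      using b(1) by (rule CI) (intro mspan_mult \<sigma>C u uz)
    also have "b * (\<sigma> (u \<otimes> z) ^ 1 * \<sigma> u ^ (r - 1)) = \<sigma> u * act u a * \<sigma> u ^ (r - 1)"
      unfolding b(2) by (simp only: mult_ac power_one_right)
    also have "\<dots> = act u a * (\<sigma> u * \<sigma> u ^ (r - 1))" by (simp only: mult_ac)
    also have "\<dots> = act u a" using power_inverse[OF \<sigma>A[OF u]] by simp
    finally show ?thesis .
  qed
  have "(\<Union>u\<in>carrier G. {act u \<alpha>, act u \<beta>}) \<subseteq> C"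
    using translate[OF KX(1)] translate[OF KX(2)] by auto
  then have "mspan (\<Union>u\<in>carrier G. {act u \<alpha>, act u \<beta>}) \<subseteq> C"
    by (intro mspan_subset C1 Cm)
  with ab(3) have "A \<subseteq> C" by (rule order_trans)
  have fin: "finite B" "finite (mspan (\<sigma> ` carrier G))"
    using finite_subset[OF BA finite_module] finite_mspan[of "\<sigma> ` carrier G" r] finite_group r_pos exponent \<sigma>A
    by auto
  have "card A \<le> card C" using \<open>A \<subseteq> C\<close> fin by (intro card_mono) (auto simp: C_def)
  also have "\<dots> \<le> card B * card (mspan (\<sigma> ` carrier G))"
    unfolding C_def using fin card_image_le[of "B \<times> mspan (\<sigma> ` carrier G)"]
    by (metis card_cartesian_product finite_cartesian_product)
  also have "\<dots> \<le> card B * r ^ card (\<sigma> ` carrier G)"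
    using finite_group r_pos exponent \<sigma>A by (intro mult_le_mono2 card_mspan_le) auto
  also have "\<dots> \<le> card B * r ^ order G"
    using r_pos finite_group card_image_le by (auto simp: order_def intro!: power_increasing)
  finally show thesis using that[OF B _ XY gen] by blast
qed

end

section \<open>The free module of rank two\<close>

text \<open>For varying \<open>r\<close> there is no single type of integers modulo \<open>r\<close>; the complex numbers contain a
  cyclic group of every order, so functions into the \<open>r\<close>-th roots of unity, multiplied pointwise,
  serve as the vectors over the field with \<open>r\<close> elements.\<close>

lemma prod_fun_apply: "(\<Prod>i\<in>I. F i) j = (\<Prod>i\<in>I. F i j)"
  for F :: "'i \<Rightarrow> 'j \<Rightarrow> 'm::comm_monoid_mult"
  by (induction I rule: infinite_finite_induct) simp_all

lemma power_fun_apply: "(f ^ n) j = f j ^ n"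
  for f :: "'j \<Rightarrow> 'm::comm_monoid_mult"
  by (induction n) simp_all

definition root_functions :: "'i set \<Rightarrow> nat \<Rightarrow> ('i \<Rightarrow> complex) set" where
  "root_functions I r = {f. (\<forall>i\<in>I. f i ^ r = 1) \<and> (\<forall>i. i \<notin> I \<longrightarrow> f i = 1)}"

lemma card_root_functions:
  assumes "finite I" "r > 0"
  shows "card (root_functions I r) = r ^ card I"
proof -
  let ?U = "{z::complex. z ^ r = 1}"
  have "bij_betw (\<lambda>f. restrict f I) (root_functions I r) (PiE I (\<lambda>_. ?U))"
    by (rule bij_betw_byWitness[of _ "\<lambda>f i. if i \<in> I then f i else 1"])
      (auto simp: root_functions_def fun_eq_iff PiE_iff extensional_def)
  then have "card (root_functions I r) = card (PiE I (\<lambda>_. ?U))" by (rule bij_betw_same_card)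
  also have "\<dots> = r ^ card I" using assms by (simp add: card_PiE card_roots_unity_eq)
  finally show ?thesis .
qed

lemma root_of_unity_is_power:
  assumes "r > 0" "(z::complex) ^ r = 1"
  shows "\<exists>k. z = cis (2 * pi / real r) ^ k"
proof -
  have "z \<in> (\<lambda>k. cis (2 * pi * real k / real r)) ` {..<r}"
    using bij_betw_roots_unity[OF assms(1)] assms(2) by (simp add: bij_betw_def)
  then show ?thesis by (auto simp: DeMoivre mult_ac)
qed

definition single :: "'i \<Rightarrow> complex \<Rightarrow> 'i \<Rightarrow> complex" where
  "single i z = (\<lambda>j. if j = i then z else 1)"

lemma root_functions_subset_mspan:
  assumes "finite I" "r > 0"
  shows "root_functions I r \<subseteq> mspan ((\<lambda>i. single i (cis (2 * pi / real r))) ` I)"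
proof
  let ?\<omega> = "cis (2 * pi / real r)"
  let ?T = "(\<lambda>i. single i ?\<omega>) ` I"
  fix f assume f: "f \<in> root_functions I r"
  then have "\<exists>k. f i = ?\<omega> ^ k" if "i \<in> I" for i
    using root_of_unity_is_power[OF assms(2)] that by (auto simp: root_functions_def)
  then obtain k where k: "\<And>i. i \<in> I \<Longrightarrow> f i = ?\<omega> ^ k i" by metis
  have "f = (\<Prod>i\<in>I. single i ?\<omega> ^ k i)"
  proof
    fix j
    have "(\<Prod>i\<in>I. single i ?\<omega> ^ k i) j = (\<Prod>i\<in>I. if i = j then ?\<omega> ^ k i else 1)"
      unfolding prod_fun_apply power_fun_apply by (intro prod.cong) (auto simp: single_def)
    also have "\<dots> = f j"
      using f assms(1) k by (auto simp: prod.delta root_functions_def)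
    finally show "f j = (\<Prod>i\<in>I. single i ?\<omega> ^ k i) j" by simp
  qed
  also have "\<dots> \<in> mspan ?T"
    using assms(1) by (intro mult_closed_prod) (auto intro: mspan_one mspan_mult mspan_power mspan_base)
  finally show "f \<in> mspan ?T" .
qed

text \<open>Left translation in the first coordinate. The value off the carrier is the neutral one, which
  is the one that root functions take there.\<close>

definition translate :: "('a, 'b) monoid_scheme \<Rightarrow> 'a \<Rightarrow> ('a \<times> 'k \<Rightarrow> complex) \<Rightarrow> 'a \<times> 'k \<Rightarrow> complex" where
  "translate G g f = (\<lambda>(u, b). if u \<in> carrier G then f (inv\<^bsub>G\<^esub> g \<otimes>\<^bsub>G\<^esub> u, b) else 1)"

text \<open>The two values of the boolean coordinate make this the free module of rank two, as many ranks as
  there are generators to be lifted.\<close>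

lemma (in group) torsion_module_root_functions:
  assumes "finite (carrier G)" "r > 0" "coprime r (order G)"
  shows "torsion_module G (translate G) r (root_functions (carrier G \<times> (UNIV :: bool set)) r)"
proof unfold_locales
  show "finite (root_functions (carrier G \<times> (UNIV :: bool set)) r)"
    using card_root_functions[of "carrier G \<times> (UNIV :: bool set)" r] assms
    by (intro card_ge_0_finite) simp
qed (use assms in \<open>auto simp: root_functions_def translate_def fun_eq_iff power_fun_apply
      power_mult_distrib inv_mult_group m_assoc\<close>)

lemma (in group) translate_single:
  assumes "u \<in> carrier G"
  shows "translate G u (single (\<one>, b) z) = single (u, b) z"
proof -
  have "inv u \<otimes> v = \<one> \<longleftrightarrow> v = u" if "v \<in> carrier G" for v
    using assms that by (metis inv_closed inv_equality inv_inv l_inv)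
  then show ?thesis using assms by (auto simp: translate_def single_def fun_eq_iff)
qed

lemma (in group) root_functions_spanned_by_translates:
  assumes "finite (carrier G)" "r > 0"
  defines "\<omega> \<equiv> cis (2 * pi / real r)"
  shows "root_functions (carrier G \<times> UNIV) r \<subseteq>
    mspan (\<Union>u\<in>carrier G. {translate G u (single (\<one>, True) \<omega>), translate G u (single (\<one>, False) \<omega>)})"
proof -
  have "(\<lambda>i. single i \<omega>) ` (carrier G \<times> UNIV) =
      (\<Union>u\<in>carrier G. {translate G u (single (\<one>, True) \<omega>), translate G u (single (\<one>, False) \<omega>)})"
    by (auto simp: translate_single UNIV_bool)
  then show ?thesis
    using root_functions_subset_mspan[of "carrier G \<times> (UNIV :: bool set)" r] assms by simp
qed

section \<open>Raising the invariable rank\<close>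

lemma obtain_iso_nat_monoid:
  assumes "group G" "finite (carrier G)"
  obtains H :: "nat monoid" and f where "group H" "f \<in> iso G H"
proof -
  obtain f :: "'a \<Rightarrow> nat" where f: "inj_on f (carrier G)"
    using finite_imp_inj_to_nat_seg[OF assms(2)] by blast
  have iso: "f \<in> iso G (image_group f G)" using f by (rule inj_imp_image_group_iso)
  then have "group (image_group f G)"
    using group.iso_imp_img_group[OF assms(1) iso] by (simp add: image_group_def)
  with iso show thesis using that by blast
qed

text \<open>The module part \<open>B\<close> of the extension has at least \<open>r\<close> to the power \<open>|G|\<close> elements, because the
  free module has \<open>r\<close> to the power \<open>2 |G|\<close>. An invariably generating set of the extension with at
  most \<open>d\<^sub>I(G)\<close> elements would map onto one of \<open>G\<close>; minimality forces all its images to be nontrivial,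
  and then the set is excluded, since its size is below the order of every nontrivial element of
  \<open>G\<close>.\<close>

theorem exists_extension_with_larger_inv_gen_rank:
  fixes G :: "('a, 'b) monoid_scheme"
  assumes "group G"
    and fin: "finite (carrier G)"
    and nontriv: "carrier G \<noteq> {\<one>\<^bsub>G\<^esub>}"
    and solv: "solvable G"
    and gen: "\<exists>x \<in> carrier G. \<exists>y \<in> carrier G. generates G {x, y}"
    and small: "inv_gen_rank G < Min (group_primes G)"
  shows "\<exists>H :: (('a \<times> bool \<Rightarrow> complex) \<times> 'a) monoid.
        group H \<and> finite (carrier H) \<and> solvable H \<and>
        (\<exists>f. f \<in> epi H G) \<and>
        gen_rank H = 2 \<and>
        inv_gen_rank H > inv_gen_rank G \<and>
        Min (group_primes H) = Min (group_primes G)"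
proof -
  interpret group G by fact
  \<comment> \<open>Being larger than the order of \<open>G\<close>, the new prime is coprime to it and above its least prime.\<close>
  obtain r where r: "prime r" "r > order G" using bigger_prime by blast
  have n: "order G > 0" using fin by (simp add: order_gt_0_iff_finite)
  have r1: "r > 1" using r prime_gt_1_nat by blast
  have "\<not> r dvd order G" using r(2) n by (auto dest: dvd_imp_le)
  then have coprime: "coprime r (order G)" using r(1) by (simp add: prime_imp_coprime)
  define A where "A = root_functions (carrier G \<times> (UNIV :: bool set)) r"
  interpret A: torsion_module G "translate G" r A
    unfolding A_def by (rule torsion_module_root_functions) (use fin r1 coprime in auto)
  have card_A: "card A = r ^ (2 * order G)"
    unfolding A_def using fin r1 by (simp add: card_root_functions card_cartesian_product order_def mult.commute)
  obtain x y where xy: "x \<in> carrier G" "y \<in> carrier G" "generate G {x, y} = carrier G"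
    using gen by (auto simp: generates_def)
  define \<omega> where "\<omega> = cis (2 * pi / real r)"
  have \<omega>: "\<omega> ^ r = 1" using r1 by (simp add: \<omega>_def DeMoivre)
  obtain B X Y where B: "A.submodule B" "card A \<le> card B * r ^ order G"
    and XY: "X \<in> B \<times> carrier G" "Y \<in> B \<times> carrier G" "generate (A.sdp B) {X, Y} = B \<times> carrier G"
  proof (rule A.obtain_two_generated_sdp[OF xy])
    show "single (\<one>\<^bsub>G\<^esub>, True) \<omega> \<in> A" "single (\<one>\<^bsub>G\<^esub>, False) \<omega> \<in> A"
      using \<omega> by (auto simp: A_def root_functions_def single_def)
    show "A \<subseteq> mspan (\<Union>u\<in>carrier G. {translate G u (single (\<one>\<^bsub>G\<^esub>, True) \<omega>), translate G u (single (\<one>\<^bsub>G\<^esub>, False) \<omega>)})"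
      unfolding A_def \<omega>_def using fin r1 by (intro root_functions_spanned_by_translates) auto
  qed
  have large: "r ^ order G \<le> card B"
    using B(2) r1 by (simp add: card_A mult_2 power_add)
  interpret B: torsion_module G "translate G" r B by (rule A.torsion_module_submodule) fact
  let ?H = "A.sdp B"
  have H: "group ?H" by (rule B.group_sdp)
  have finH: "finite (carrier ?H)" using fin B.finite_module by (simp add: B.carrier_sdp)
  have epi: "snd \<in> epi ?H G" by (rule B.snd_epi)
  have "inv_gen_rank G < inv_gen_rank ?H"
  proof (rule ccontr)
    assume less: "\<not> inv_gen_rank G < inv_gen_rank ?H"
    obtain S where S: "finite S" "card S = inv_gen_rank ?H" "invariably_generates ?H S"
      using obtain_min_invariably_generating_set[OF H finH] by blast
    then have "invariably_generates G (snd ` S - {\<one>\<^bsub>G\<^esub>})"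
      by (intro invariably_generates_Diff_one invariably_generates_epi_image[OF H _ epi] is_group)
    then have "inv_gen_rank G \<le> card (snd ` S - {\<one>\<^bsub>G\<^esub>})" using S(1) by (intro inv_gen_rank_le) auto
    moreover have "card (snd ` S) \<le> card S" using S(1) by (rule card_image_le)
    ultimately have "\<one>\<^bsub>G\<^esub> \<notin> snd ` S"
      using less S(1,2) card_Diff1_less[of "snd ` S" "\<one>\<^bsub>G\<^esub>"] by fastforce
    then have "snd s \<noteq> \<one>\<^bsub>G\<^esub>" if "s \<in> S" for s using that by (metis imageI)
    moreover have "S \<subseteq> B \<times> carrier G"
      using S(3) by (simp add: invariably_generates_def B.carrier_sdp)
    moreover have "card S < Min (group_primes G)" using S(2) less small by simp
    ultimately have "\<not> invariably_generates ?H S"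
      using B.not_invariably_generates[OF S(1) _ _ _ _ r1 large, of "Min (group_primes G)"]
        Min_group_primes_le_ord[OF fin] by blast
    with S(3) show False by blast
  qed
  moreover have "gen_rank ?H = 2"
  proof (rule antisym)
    have "gen_rank ?H \<le> card {X, Y}"
      using XY by (intro gen_rank_le) (auto simp: generates_def B.carrier_sdp)
    also have "\<dots> \<le> 2" by (simp add: card_insert_if)
    finally show "gen_rank ?H \<le> 2" .
    show "2 \<le> gen_rank ?H"
      using inv_gen_rank_le_1_if_gen_rank_le_1[OF H finH] inv_gen_rank_pos[OF is_group fin nontriv]
        \<open>inv_gen_rank G < inv_gen_rank ?H\<close> by linarith
  qed
  moreover have "Min (group_primes ?H) = Min (group_primes G)"
  proof (rule antisym)
    have card_H: "card (carrier ?H) = card B * order G"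
      by (simp add: B.carrier_sdp card_cartesian_product order_def)
    have "card (carrier ?H) dvd card (carrier (A.sdp A))"
      using group.lagrange[OF A.group_sdp A.subgroup_sdp[OF B(1)]]
      unfolding order_def B.carrier_sdp by (metis dvd_triv_right)
    then have dvd: "card (carrier ?H) dvd r ^ (2 * order G) * order G"
      by (simp add: A.carrier_sdp card_cartesian_product order_def card_A)
    have primes_G: "finite (group_primes G)" "group_primes G \<noteq> {}"
      using finite_nonempty_group_primes[OF is_group fin nontriv] by blast+
    have sub: "group_primes G \<subseteq> group_primes ?H"
      by (auto simp: group_primes_def card_H order_def)
    have "q = r \<or> q \<in> group_primes G" if "q \<in> group_primes ?H" for q
    proof -
      have q: "prime q" "q dvd r ^ (2 * order G) * order G"
        using that dvd by (auto simp: group_primes_def dvd_trans)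
      then have "q dvd r \<or> q dvd order G" using prime_dvd_mult_iff prime_dvd_power by blast
      then show ?thesis using q(1) r(1) by (auto simp: group_primes_def order_def primes_dvd_imp_eq)
    qed
    then have primes_H: "group_primes ?H \<subseteq> insert r (group_primes G)" by blast
    then have fin_H: "finite (group_primes ?H)" using primes_G finite_subset by blast
    show "Min (group_primes ?H) \<le> Min (group_primes G)"
      using sub primes_G(2) fin_H by (rule Min_antimono)
    have "Min (group_primes G) \<in> group_primes G" using primes_G by simp
    then have "Min (group_primes G) \<le> r"
      using r(2) n dvd_imp_le[of "Min (group_primes G)" "order G"]
      by (auto simp: group_primes_def order_def)
    moreover have "Min (group_primes ?H) \<in> group_primes ?H"
      using fin_H sub primes_G(2) by (intro Min_in) auto
    then have "Min (group_primes ?H) = r \<or> Min (group_primes ?H) \<in> group_primes G"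
      using primes_H by blast
    ultimately show "Min (group_primes G) \<le> Min (group_primes ?H)"
      using primes_G(1) by auto
  qed
  ultimately show ?thesis
    using H finH B.solvable_sdp[OF solv] epi by blast
qed

theorem theorem8:
  fixes G :: "('a, 'b) monoid_scheme"
  assumes "group G"
    and "finite (carrier G)"
    and "carrier G \<noteq> {\<one>\<^bsub>G\<^esub>}"
    and "solvable G"
    and "\<exists>x \<in> carrier G. \<exists>y \<in> carrier G. generates G {x, y}"
  shows "inv_gen_rank G \<ge> Min (group_primes G) \<or>
    (\<exists>H :: nat monoid.
        group H \<and> finite (carrier H) \<and> solvable H \<and>
        (\<exists>f. f \<in> epi H G) \<and>
        gen_rank H = 2 \<and>
        inv_gen_rank H > inv_gen_rank G \<and>
        Min (group_primes H) = Min (group_primes G))"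
proof (unfold disj_imp, rule impI)
  assume "\<not> inv_gen_rank G \<ge> Min (group_primes G)"
  then obtain K :: "(('a \<times> bool \<Rightarrow> complex) \<times> 'a) monoid" and f where
    K: "group K" "finite (carrier K)" "solvable K" "f \<in> epi K G" "gen_rank K = 2"
      "inv_gen_rank K > inv_gen_rank G" "Min (group_primes K) = Min (group_primes G)"
    using exists_extension_with_larger_inv_gen_rank[OF assms] by auto
  obtain H :: "nat monoid" and h where H: "group H" and h: "h \<in> iso K H"
    using obtain_iso_nat_monoid[OF K(1,2)] by blast
  have h': "inv_into (carrier K) h \<in> iso H K" using group.iso_set_sym[OF K(1) h] .
  have epis: "h \<in> epi K H" "inv_into (carrier K) h \<in> epi H K" using h h' by (simp_all add: iso_iff_mon_epi)
  have card: "card (carrier H) = card (carrier K)" and finH: "finite (carrier H)"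
    using h K(2) bij_betw_same_card bij_betw_finite by (fastforce simp: iso_def)+
  have "gen_rank H = gen_rank K" "inv_gen_rank H = inv_gen_rank K"
    using gen_rank_epi_le inv_gen_rank_epi_le epis H finH K(1,2) by (metis antisym)+
  moreover have "group_primes H = group_primes K" by (simp add: group_primes_def card)
  moreover have "solvable H"
    using group_hom.surj_hom_imp_solvable[of K H h] epis(1) H K(1,3)
    by (simp add: epi_def group_hom_def group_hom_axioms_def)
  moreover have "f \<circ> inv_into (carrier K) h \<in> epi H G" using epi_compose[OF epis(2) K(4)] .
  ultimately show "\<exists>H :: nat monoid.
        group H \<and> finite (carrier H) \<and> solvable H \<and>
        (\<exists>f. f \<in> epi H G) \<and>
        gen_rank H = 2 \<and>
        inv_gen_rank H > inv_gen_rank G \<and>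
        Min (group_primes H) = Min (group_primes G)"
    using H finH K(5-7) by metis
qed

end
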